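(* Let $n\ge 1$, let $M>0$, and let $K=K_1\times\dots\times K_n\subset\mathbb{C}^n$, where $K_1,\dots,K_n\subset\mathbb{C}$ are (nonempty) compact sets. Suppose that $K$ is a Bernstein set of parameter $M$, i.e. for every $m\in\{1,\dots,n\}$, every $d\in\mathbb{N}$ and every polynomial $P\in\mathcal{P}_d(\mathbb{C}^n)$, $$\max_{z\in K}\left|\frac{\partial P}{\partial z_m}(z)\right|\le M\,d\,\max_{z\in K}|P(z)|.$$ Then the transfinite diameter $\delta(K)$ of $K$ satisfies $$\delta(K)\ge\frac{1}{M}.$$
   Context: $\mathbb{N}=\{0,1,2,\dots\}$. $\mathcal{P}_d(\mathbb{C}^n)$ is the space of holomorphic polynomials in $n$ complex variables with complex coefficients of total degree at most $d$; its dimension is $h_d=\binom{n+d}{n}$. For $\beta\in\mathbb{N}^n$, $|\beta|=\beta_1+\dots+\beta_n$. The graded lexicographical order on $\mathbb{N}^n$: $\beta\prec\gamma$ iff $|\beta|<|\gamma|$, or $|\beta|=|\gamma|$ and the leftmost nonzero entry of $\gamma-\beta$ is positive. Let $\alpha:\mathbb{N}\to\mathbb{N}^n$, $j\mapsto\alpha(j)=(\alpha_1(j),\dots,\alpha_n(j))$, be the increasing enumeration of $\mathbb{N}^n$ for this order (so $\alpha(0)=(0,\dots,0)$), and let $e_j(z)=z^{\alpha(j)}=z_1^{\alpha_1(j)}\cdots z_n^{\alpha_n(j)}$ for $j\in\mathbb{N}$. For points $\xi_0,\dots,\xi_{k-1}\in\mathbb{C}^n$ let $\mathrm{VDM}(\xi_0,\dots,\xi_{k-1})=\det[e_i(\xi_j)]_{i,j=0,\dots,k-1}$.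 For a compact set $K\subset\mathbb{C}^n$ let $V_k=\max_{\xi_0,\dots,\xi_{k-1}\in K}|\mathrm{VDM}(\xi_0,\dots,\xi_{k-1})|$, and let $l_d=\sum_{i=1}^d i(h_i-h_{i-1})=n\binom{n+d}{n+1}$. The transfinite diameter of $K$ is $$\delta(K)=\limsup_{d\to+\infty}V_{h_d}^{1/l_d}.$$ *)

theory Defs
  imports "HOL-Analysis.Analysis" "Jordan_Normal_Form.Determinant"
begin

(* Both libraries use $ for vector components; here it always means vec_nth. *)
no_notation Matrix.vec_index (infixl "$" 100)

(* The coordinates 1 < ... < n are the elements of a finite linearly ordered type 'n, so that
   n = CARD('n) \<ge> 1, C^n is complex ^ 'n and N^n is nat ^ 'n. The order on 'n is what
   "leftmost entry" refers to. *)

section \<open>Multi-indices, monomials and polynomials\<close>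

definition mdeg :: "nat ^ 'n::finite \<Rightarrow> nat" where
  "mdeg \<beta> = (\<Sum>i\<in>UNIV. \<beta> $ i)"

definition zpow :: "complex ^ 'n::finite \<Rightarrow> nat ^ 'n \<Rightarrow> complex" where
  "zpow z \<beta> = (\<Prod>i\<in>UNIV. z $ i ^ (\<beta> $ i))"

(* The index set is finite, see finite_mdeg_le. *)
definition polys :: "nat \<Rightarrow> (complex ^ 'n::finite \<Rightarrow> complex) set" where
  "polys d = {P. \<exists>c. P = (\<lambda>z. \<Sum>\<beta> | mdeg \<beta> \<le> d. c \<beta> * zpow z \<beta>)}"

definition partial_deriv :: "'n::finite \<Rightarrow> (complex ^ 'n \<Rightarrow> complex) \<Rightarrow> complex ^ 'n \<Rightarrow> complex" where
  "partial_deriv m P z = deriv (\<lambda>w. P (\<chi> i. if i = m then w else z $ i)) (z $ m)"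

definition grlex :: "nat ^ 'n::{finite,linorder} \<Rightarrow> nat ^ 'n::{finite,linorder} \<Rightarrow> bool" where
  "grlex \<beta> \<gamma> \<longleftrightarrow> mdeg \<beta> < mdeg \<gamma> \<or>
     (mdeg \<beta> = mdeg \<gamma> \<and> (\<exists>i. \<beta> $ i < \<gamma> $ i \<and> (\<forall>k<i. \<beta> $ k = \<gamma> $ k)))"

(* The increasing enumeration of N^n; it exists and is unique by ex1_enumeration. *)
definition enum_idx :: "nat \<Rightarrow> nat ^ 'n::{finite,linorder}" where
  "enum_idx = (THE a. bij a \<and> (\<forall>i j. i < j \<longrightarrow> grlex (a i) (a j)))"

definition e_mon :: "nat \<Rightarrow> complex ^ 'n::{finite,linorder} \<Rightarrow> complex" where
  "e_mon j z = zpow z (enum_idx j)"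

section \<open>Bernstein sets\<close>

(* On a nonempty compact set the supremum is a maximum for continuous f, see sup_norm_attained. *)
definition sup_norm :: "'a set \<Rightarrow> ('a \<Rightarrow> complex) \<Rightarrow> real" where
  "sup_norm K f = (SUP z\<in>K. cmod (f z))"

definition bernstein_set :: "real \<Rightarrow> (complex ^ 'n::finite) set \<Rightarrow> bool" where
  "bernstein_set M K \<longleftrightarrow>
     (\<forall>m d. \<forall>P\<in>polys d. sup_norm K (partial_deriv m P) \<le> M * real d * sup_norm K P)"

section \<open>Transfinite diameter\<close>

definition VDM :: "nat \<Rightarrow> (nat \<Rightarrow> complex ^ 'n::{finite,linorder}) \<Rightarrow> complex" where
  "VDM k \<xi> = Determinant.det (Matrix.mat k k (\<lambda>(i, j). e_mon i (\<xi> j)))"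

(* Only the values \<xi> j for j < k matter. *)
definition V_max :: "nat \<Rightarrow> (complex ^ 'n::{finite,linorder}) set \<Rightarrow> real" where
  "V_max k K = (SUP \<xi> \<in> {..<k} \<rightarrow> K. cmod (VDM k \<xi>))"

definition h_num :: "nat \<Rightarrow> nat \<Rightarrow> nat" where
  "h_num n d = (n + d) choose n"

(* The subtraction on nat does not truncate, since h_num n is monotone. *)
definition l_num :: "nat \<Rightarrow> nat \<Rightarrow> nat" where
  "l_num n d = (\<Sum>i=1..d. i * (h_num n i - h_num n (i - 1)))"

definition transfinite_diameter :: "(complex ^ 'n::{finite,linorder}) set \<Rightarrow> ereal" where
  "transfinite_diameter K =
     limsup (\<lambda>d. ereal (V_max (h_num CARD('n) d) K powr (1 / real (l_num CARD('n) d))))"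

section \<open>Well-definedness\<close>

lemma le_mdeg: "\<beta> $ i \<le> mdeg \<beta>"
  unfolding mdeg_def by (rule member_le_sum) auto

lemma finite_mdeg_le: "finite {\<beta> :: nat ^ 'n::finite. mdeg \<beta> \<le> d}"
proof -
  have "finite {f :: 'n \<Rightarrow> nat. range f \<subseteq> {..d}}"
    using finite_PiE[of "UNIV :: 'n set" "\<lambda>_. {..d}"]
    by (simp add: PiE_UNIV_domain Pi_def image_subset_iff)
  moreover have "{\<beta> :: nat ^ 'n. mdeg \<beta> \<le> d} \<subseteq> vec_lambda ` {f. range f \<subseteq> {..d}}"
  proof
    fix \<beta> :: "nat ^ 'n"
    assume "\<beta> \<in> {\<beta>. mdeg \<beta> \<le> d}"
    then have "\<beta> $ i \<le> d" for i using le_mdeg[of \<beta> i] by simp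
    then have "range (vec_nth \<beta>) \<subseteq> {..d}" by auto
    then show "\<beta> \<in> vec_lambda ` {f. range f \<subseteq> {..d}}"
      by (metis (mono_tags, lifting) image_eqI mem_Collect_eq vec_nth_inverse)
  qed
  ultimately show ?thesis by (meson finite_imageI finite_subset)
qed

lemma grlex_irrefl: "\<not> grlex \<beta> \<beta>"
  unfolding grlex_def by simp

lemma grlex_trans:
  assumes "grlex \<beta> \<gamma>" "grlex \<gamma> \<delta>"
  shows "grlex \<beta> \<delta>"
proof (cases "mdeg \<beta> = mdeg \<gamma> \<and> mdeg \<gamma> = mdeg \<delta>")
  case True
  then obtain i j where i: "\<beta> $ i < \<gamma> $ i" "\<forall>k<i. \<beta> $ k = \<gamma> $ k"
    and j: "\<gamma> $ j < \<delta> $ j" "\<forall>k<j. \<gamma> $ k = \<delta> $ k"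
    using assms unfolding grlex_def by auto
  have "\<beta> $ (min i j) < \<delta> $ (min i j) \<and> (\<forall>k < min i j. \<beta> $ k = \<delta> $ k)"
  proof (cases i j rule: linorder_cases)
    case less
    then show ?thesis using i j by (simp add: min_def)
  next
    case equal
    then show ?thesis using i j by simp
  next
    case greater
    then show ?thesis using i j by (simp add: min_def)
  qed
  then show ?thesis using True unfolding grlex_def by auto
next
  case False
  then show ?thesis using assms unfolding grlex_def by auto
qed

lemma grlex_total:
  fixes \<beta> \<gamma> :: "nat ^ 'n::{finite,linorder}"
  assumes "\<beta> \<noteq> \<gamma>"
  shows "grlex \<beta> \<gamma> \<or> grlex \<gamma> \<beta>"
proof -
  define D where "D = {i. \<beta> $ i \<noteq> \<gamma> $ i}"
  have ne: "D \<noteq> {}" using assms by (auto simp: D_def Finite_Cartesian_Product.vec_eq_iff)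
  have "Min D \<in> D" using ne by (intro Min_in) auto
  moreover have "\<beta> $ k = \<gamma> $ k" if "k < Min D" for k
  proof (rule ccontr)
    assume "\<beta> $ k \<noteq> \<gamma> $ k"
    then have "Min D \<le> k" by (intro Min_le) (auto simp: D_def)
    then show False using that by simp
  qed
  ultimately have "\<exists>i. (\<beta> $ i < \<gamma> $ i \<or> \<gamma> $ i < \<beta> $ i) \<and> (\<forall>k<i. \<beta> $ k = \<gamma> $ k)"
    unfolding D_def using linorder_neq_iff by blast
  then show ?thesis unfolding grlex_def by (metis linorder_neq_iff)
qed

lemma finite_grlex_below: "finite {\<gamma>. grlex \<gamma> \<beta>}"
  by (rule finite_subset[OF _ finite_mdeg_le[of "mdeg \<beta>"]]) (auto simp: grlex_def)

lemma ex1_enumeration: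
  "\<exists>!a :: nat \<Rightarrow> nat ^ 'n::{finite,linorder}. bij a \<and> (\<forall>i j. i < j \<longrightarrow> grlex (a i) (a j))"
proof -
  define r where "r = (\<lambda>\<beta> :: nat ^ 'n::{finite,linorder}. card {\<gamma>. grlex \<gamma> \<beta>})"
  have mono: "r \<beta> < r \<gamma>" if "grlex \<beta> \<gamma>" for \<beta> \<gamma>
    unfolding r_def
  proof (rule psubset_card_mono[OF finite_grlex_below])
    show "{\<delta>. grlex \<delta> \<beta>} \<subset> {\<delta>. grlex \<delta> \<gamma>}"
      using that grlex_irrefl[of \<beta>] grlex_trans by blast
  qed
  have inj: "inj r"
    by (rule injI) (metis grlex_total less_irrefl mono)
  have surj: "k \<in> range r" for k
  proof -
    define S where "S = {\<beta> :: nat ^ 'n::{finite,linorder}. mdeg \<beta> \<le> k}"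
    have fS: "finite S" unfolding S_def by (rule finite_mdeg_le)
    have sub: "r ` S \<subseteq> {..<card S}"
    proof
      fix x assume "x \<in> r ` S"
      then obtain \<beta> where \<beta>: "\<beta> \<in> S" "x = r \<beta>" by auto
      have "{\<gamma>. grlex \<gamma> \<beta>} \<subset> S"
        using \<beta>(1) grlex_irrefl[of \<beta>] by (auto simp: S_def grlex_def)
      then show "x \<in> {..<card S}"
        using \<beta>(2) fS unfolding r_def by (simp add: psubset_card_mono)
    qed
    have "card (r ` S) = card S"
      by (rule card_image) (meson inj inj_on_subset subset_UNIV)
    then have eq: "r ` S = {..<card S}"
      using sub by (intro card_subset_eq) auto
    obtain i0 :: 'n where True by simp
    define g where "g = (\<lambda>m. (\<chi> i. if i = i0 then m else 0) :: nat ^ 'n::{finite,linorder})"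
    have "mdeg (g m) = m" for m unfolding mdeg_def g_def by simp
    then have "g ` {..k} \<subseteq> S" by (auto simp: S_def)
    moreover have "inj_on g {..k}"
      by (rule inj_onI) (metis \<open>\<And>m. mdeg (g m) = m\<close>)
    ultimately have "Suc k \<le> card S"
      using card_inj_on_le[of g "{..k}" S] fS by simp
    then show ?thesis using eq by (metis Suc_le_lessD imageE lessThan_iff rangeI)
  qed
  have bij: "bij r" using inj surj by (auto simp: bij_def)
  show ?thesis
  proof (rule ex1I[of _ "inv_into UNIV r"])
    show "bij (inv_into UNIV r) \<and> (\<forall>i j. i < j \<longrightarrow> grlex (inv_into UNIV r i) (inv_into UNIV r j))"
    proof (intro conjI allI impI)
      show "bij (inv_into UNIV r)" using bij by (rule bij_imp_bij_inv)
      fix i j :: nat assume "i < j"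
      moreover have "r (inv_into UNIV r i) = i" "r (inv_into UNIV r j) = j"
        using bij by (auto simp: bij_def surj_f_inv_f)
      ultimately show "grlex (inv_into UNIV r i) (inv_into UNIV r j)"
        by (metis grlex_total less_asym less_irrefl mono)
    qed
  next
    fix a :: "nat \<Rightarrow> nat ^ 'n::{finite,linorder}"
    assume a: "bij a \<and> (\<forall>i j. i < j \<longrightarrow> grlex (a i) (a j))"
    have "r (a i) = i" for i
    proof -
      have "{\<gamma>. grlex \<gamma> (a i)} = a ` {..<i}"
      proof (intro equalityI subsetI)
        fix \<gamma> assume g: "\<gamma> \<in> {\<gamma>. grlex \<gamma> (a i)}"
        obtain j where j: "\<gamma> = a j" using a by (metis bij_pointE)
        have "\<not> i \<le> j"
          using g j a grlex_irrefl grlex_trans by (metis mem_Collect_eq le_neq_implies_less)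
        then show "\<gamma> \<in> a ` {..<i}" using j by auto
      qed (use a in auto)
      then show ?thesis unfolding r_def using a
        by (simp add: card_image bij_def inj_on_subset[OF _ subset_UNIV])
    qed
    then show "a = inv_into UNIV r" using inj by (metis ext inv_f_eq)
  qed
qed

lemma enum_idx: "bij enum_idx" "i < j \<Longrightarrow> grlex (enum_idx i) (enum_idx j)"
  using theI'[OF ex1_enumeration] unfolding enum_idx_def[symmetric] by auto

lemma sup_norm_attained:
  assumes "compact K" "K \<noteq> {}" "continuous_on K f"
  obtains z where "z \<in> K" "cmod (f z) = sup_norm K f" "\<And>w. w \<in> K \<Longrightarrow> cmod (f w) \<le> cmod (f z)"
proof -
  have "continuous_on K (\<lambda>z. cmod (f z))" using assms(3) by (intro continuous_intros)
  then obtain z where z: "z \<in> K" "\<And>w. w \<in> K \<Longrightarrow> cmod (f w) \<le> cmod (f z)"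
    using continuous_attains_sup[OF assms(1,2)] by blast
  moreover have "sup_norm K f = cmod (f z)"
    unfolding sup_norm_def using z by (intro cSup_eq_maximum) auto
  ultimately show thesis using that by simp
qed

lemma l_num_eq: "l_num n d = n * ((n + d) choose (n + 1))"
proof (induction d)
  case 0
  then show ?case by (simp add: l_num_def)
next
  case (Suc d)
  have "l_num n (Suc d) = l_num n d + Suc d * (h_num n (Suc d) - h_num n d)"
    by (simp add: l_num_def)
  also have "Suc d * (h_num n (Suc d) - h_num n d) = n * ((n + d) choose n)"
  proof (cases n)
    case 0
    then show ?thesis by (simp add: h_num_def)
  next
    case (Suc m)
    have "h_num n (Suc d) - h_num n d = (n + d) choose m"
      by (simp add: h_num_def Suc)
    moreover have "Suc d * ((n + d) choose m) = n * ((n + d) choose n)"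
      using Suc_times_binomial_add[of m d] by (simp add: Suc algebra_simps)
    ultimately show ?thesis by simp
  qed
  finally show ?case using Suc.IH by (simp add: algebra_simps)
qed

end

theory Submission
  imports Defs
begin

text \<open>
  Restricting the Bernstein inequality to polynomials in the single variable \<open>z\<^sub>i\<close> and
  differentiating \<open>k\<close> times shows that a monic polynomial of degree \<open>k\<close> has supremum norm at least
  \<open>M\<^sup>-\<^sup>k\<close> on \<open>K\<^sub>i\<close>. Choose a Leja sequence \<open>x\<^sup>i\<close> in every \<open>K\<^sub>i\<close>: the point \<open>x\<^sup>i\<^sub>k\<close> maximises the
  modulus of the Newton polynomial \<open>N\<^sup>i\<^sub>k = (\<Prod>j<k. z - x\<^sup>i\<^sub>j)\<close>, so that \<open>\<bar>N\<^sup>i\<^sub>k (x\<^sup>i\<^sub>k)\<bar> \<ge> M\<^sup>-\<^sup>k\<close>.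
  At the points with coordinates \<open>x\<^sup>i\<close> of index \<open>\<beta>\<^sub>i\<close>, for \<open>\<bar>\<beta>\<bar> \<le> d\<close>, the Vandermonde determinant
  does not change when the monomials are replaced by products of Newton polynomials, and it becomes
  triangular. Its modulus is therefore at least \<open>\<Prod>\<^sub>\<beta> (1 / M) ^ \<bar>\<beta>\<bar> = (1 / M) ^ l\<^sub>d\<close>.
\<close>

section \<open>Counting multi-indices\<close>

text \<open>Stars and bars: prepending the slack \<open>d - mdeg \<beta>\<close> turns the
  inequality into an equality, so that lists of length n + 1 with sum \<open>d\<close> are
  counted.\<close>

lemma card_mdeg_le: "card {\<beta> :: nat ^ 'n::finite. mdeg \<beta> \<le> d} = h_num CARD('n) d"
proof -
  obtain xs :: "'n list" where xs: "set xs = UNIV" "distinct xs"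
    using finite_distinct_list[of "UNIV :: 'n set"] by auto
  have len: "length xs = CARD('n)" using xs distinct_card by metis
  have mdeg_xs: "mdeg \<beta> = sum_list (map (vec_nth \<beta>) xs)" for \<beta> :: "nat ^ 'n"
    unfolding mdeg_def using xs by (simp add: sum_list_distinct_conv_sum_set)
  let ?F = "\<lambda>\<beta> :: nat ^ 'n. (d - mdeg \<beta>) # map (vec_nth \<beta>) xs"
  let ?L = "{l :: nat list. length l = Suc CARD('n) \<and> sum_list l = d}"
  have "bij_betw ?F {\<beta>. mdeg \<beta> \<le> d} ?L"
    unfolding bij_betw_def
  proof (intro conjI equalityI subsetI)
    show "inj_on ?F {\<beta>. mdeg \<beta> \<le> d}"
      using xs by (auto intro!: inj_onI simp: Finite_Cartesian_Product.vec_eq_iff)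
  next
    fix l assume "l \<in> ?F ` {\<beta>. mdeg \<beta> \<le> d}"
    then show "l \<in> ?L" using len by (auto simp: mdeg_xs)
  next
    fix l assume l: "l \<in> ?L"
    then obtain y ys where ys: "l = y # ys" "length ys = CARD('n)" by (cases l) auto
    \<comment> \<open>The inverse of \<open>nth xs\<close> gives the position of the coordinate
      \<open>i\<close> in \<open>xs\<close>; the entry of \<open>ys\<close> at that position becomes
      the \<open>i\<close>-th entry.\<close>
    define \<beta> :: "nat ^ 'n" where "\<beta> = (\<chi> i. ys ! (inv_into {..<length xs} (nth xs) i))"
    have "inj_on (nth xs) {..<length xs}"
      using xs(2) by (intro inj_onI) (simp add: nth_eq_iff_index_eq)
    then have "map (vec_nth \<beta>) xs = ys"
      using len ys(2) by (intro nth_equalityI) (auto simp: \<beta>_def inv_into_f_f)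
    moreover from this have "y + mdeg \<beta> = d" using l ys(1) by (simp add: mdeg_xs)
    ultimately show "l \<in> ?F ` {\<beta>. mdeg \<beta> \<le> d}"
      using ys(1) by (intro image_eqI[of _ _ \<beta>]) auto
  qed
  then have "card {\<beta> :: nat ^ 'n. mdeg \<beta> \<le> d} = card ?L" by (rule bij_betw_same_card)
  also have "\<dots> = (CARD('n) + d) choose d" by (simp add: card_length_sum_list add.commute)
  also have "\<dots> = h_num CARD('n) d" unfolding h_num_def
    using binomial_symmetric[of d "CARD('n) + d"] by simp
  finally show ?thesis .
qed

lemma sum_mdeg_le: "(\<Sum>\<beta> :: nat ^ 'n::finite | mdeg \<beta> \<le> d. mdeg \<beta>) = l_num CARD('n) d"
proof (induction d)
  case 0
  then show ?case by (simp add: l_num_def)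
next
  case (Suc d)
  let ?S = "\<lambda>d. {\<beta> :: nat ^ 'n. mdeg \<beta> \<le> d}"
  have sub: "?S d \<subseteq> ?S (Suc d)" by auto
  have "(\<Sum>\<beta>\<in>?S (Suc d). mdeg \<beta>) = (\<Sum>\<beta>\<in>?S (Suc d) - ?S d. mdeg \<beta>) + (\<Sum>\<beta>\<in>?S d. mdeg \<beta>)"
    by (rule sum.subset_diff[OF sub finite_mdeg_le])
  also have "(\<Sum>\<beta>\<in>?S (Suc d) - ?S d. mdeg \<beta>) = (\<Sum>\<beta>\<in>?S (Suc d) - ?S d. Suc d)"
    by (rule sum.cong) auto
  also have "\<dots> = Suc d * (h_num CARD('n) (Suc d) - h_num CARD('n) d)"
    using card_Diff_subset[OF finite_mdeg_le sub] by (simp add: card_mdeg_le)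
  finally show ?case using Suc.IH by (simp add: l_num_def)
qed

lemma down_closed_nat_eq_lessThan:
  fixes A :: "nat set"
  assumes "finite A" "\<And>i j. j \<in> A \<Longrightarrow> i < j \<Longrightarrow> i \<in> A"
  shows "A = {..<card A}"
proof (cases "A = {}")
  case False
  then have "A = {..Max A}"
    using assms Max_in[OF assms(1)] Max_ge[OF assms(1)] by (metis antisym_conv2 atMost_iff subsetI subset_antisym)
  then show ?thesis by (metis card_atMost lessThan_Suc_atMost)
qed simp

text \<open>Since \<open>grlex\<close> compares degrees first, the positions of the multi-indices of
  degree at most \<open>d\<close> form an initial segment of the naturals; its length is their
  number.\<close>

lemma enum_idx_image_lessThan:
  "enum_idx ` {..<h_num CARD('n) d} = {\<beta> :: nat ^ 'n::{finite,linorder}. mdeg \<beta> \<le> d}"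
proof -
  let ?S = "{\<beta> :: nat ^ 'n::{finite,linorder}. mdeg \<beta> \<le> d}"
  let ?A = "enum_idx -` ?S"
  have inj: "inj (enum_idx :: nat \<Rightarrow> nat ^ 'n::{finite,linorder})" and surj: "surj (enum_idx :: nat \<Rightarrow> nat ^ 'n::{finite,linorder})"
    using enum_idx(1) by (auto simp: bij_def)
  have img: "enum_idx ` ?A = ?S" using surj by (rule surj_image_vimage_eq)
  have "card ?A = h_num CARD('n) d"
    using card_image[OF inj_on_subset[OF inj subset_UNIV], of ?A] img card_mdeg_le by metis
  moreover have "?A = {..<card ?A}"
  proof (rule down_closed_nat_eq_lessThan)
    show "finite ?A" using finite_mdeg_le inj by (rule finite_vimageI)
    show "i \<in> ?A" if "j \<in> ?A" "i < j" for i j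
      proof -
      have "grlex (enum_idx i :: nat ^ 'n::{finite,linorder}) (enum_idx j)" using that(2) by (rule enum_idx(2))
      then show ?thesis using that(1) by (auto simp: grlex_def)
    qed
  qed
  ultimately show ?thesis using img by simp
qed

lemma sum_mdeg_enum_idx:
  "(\<Sum>j<h_num CARD('n) d. mdeg (enum_idx j :: nat ^ 'n::{finite,linorder})) = l_num CARD('n) d"
proof -
  have "inj_on (enum_idx :: nat \<Rightarrow> nat ^ 'n::{finite,linorder}) {..<h_num CARD('n) d}"
    using enum_idx(1) by (auto simp: bij_def intro: inj_on_subset)
  from sum.reindex[OF this, of mdeg] show ?thesis
    by (simp add: enum_idx_image_lessThan sum_mdeg_le)
qed

text \<open>A multi-index dominated in every entry by an earlier one has no larger degree, and in a
  tie of degrees \<open>grlex\<close> would require some larger entry. This is the source of both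
  triangular matrices in \<open>VDM_newton_grid\<close>.\<close>

lemma enum_idx_less_at:
  assumes "i < j"
  obtains m where "(enum_idx i :: nat ^ 'n::{finite,linorder}) $ m < enum_idx j $ m"
proof (rule ccontr)
  assume "\<not> thesis"
  then have le: "(enum_idx j :: nat ^ 'n::{finite,linorder}) $ m \<le> enum_idx i $ m" for m
    using that not_le by blast
  then have "mdeg (enum_idx j :: nat ^ 'n::{finite,linorder}) \<le> mdeg (enum_idx i :: nat ^ 'n::{finite,linorder})"
    unfolding mdeg_def by (rule sum_mono)
  moreover have "grlex (enum_idx i :: nat ^ 'n::{finite,linorder}) (enum_idx j)" using assms by (rule enum_idx(2))
  ultimately show False using le unfolding grlex_def by (metis not_le)
qed

section \<open>Newton polynomials and Leja sequences\<close>

definition newton :: "(nat \<Rightarrow> 'a::comm_ring_1) \<Rightarrow> nat \<Rightarrow> 'a poly" where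
  "newton x k = (\<Prod>j<k. [:- x j, 1:])"

lemma newton_cong: "(\<And>j. j < k \<Longrightarrow> x j = y j) \<Longrightarrow> newton x k = newton y k"
  unfolding newton_def by (intro prod.cong) auto

lemma degree_newton [simp]: "degree (newton x k) = k"
  for x :: "nat \<Rightarrow> 'a::idom"
  unfolding newton_def by (subst degree_prod_eq_sum_degree) auto

lemma lead_coeff_newton [simp]: "coeff (newton x k) k = 1"
  for x :: "nat \<Rightarrow> 'a::idom"
proof -
  have "lead_coeff (newton x k) = 1" unfolding newton_def by (simp add: lead_coeff_prod)
  then show ?thesis by simp
qed

lemma poly_newton_eq_0: "j < k \<Longrightarrow> poly (newton x k) (x j) = 0"
  unfolding newton_def poly_prod by (rule prod_zero) auto

text \<open>The polynomial \<open>newton x k\<close> involves only the points before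
  \<open>x k\<close>, so the points can be chosen one after the other, each as a maximiser supplied
  by compactness.\<close>

lemma exists_leja_sequence:
  fixes C :: "complex set"
  assumes "compact C" "C \<noteq> {}"
  shows "\<exists>x. \<forall>k. x k \<in> C \<and> cmod (poly (newton x k) (x k)) = sup_norm C (poly (newton x k))"
proof (rule dependent_wellorder_choice)
  fix r and f g :: "nat \<Rightarrow> complex" and k
  assume "\<And>j. j < k \<Longrightarrow> f j = g j"
  then have "newton f k = newton g k" by (rule newton_cong)
  then show "(r \<in> C \<and> cmod (poly (newton f k) r) = sup_norm C (poly (newton f k))) =
    (r \<in> C \<and> cmod (poly (newton g k) r) = sup_norm C (poly (newton g k)))" by simp
next
  fix k and f :: "nat \<Rightarrow> complex"
  have "continuous_on C (poly (newton f k))" by (intro continuous_intros)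
  from sup_norm_attained[OF assms this]
  show "\<exists>r. r \<in> C \<and> cmod (poly (newton f k) r) = sup_norm C (poly (newton f k))" by metis
qed

section \<open>The Bernstein inequality in one variable\<close>

lemma zpow_single: "zpow z (\<chi> i. if i = m then k else 0) = z $ m ^ k"
proof -
  have "zpow z (\<chi> i. if i = m then k else 0) = (\<Prod>i\<in>UNIV. if i = m then z $ m ^ k else 1)"
    unfolding zpow_def by (rule prod.cong) auto
  then show ?thesis by simp
qed

lemma poly_nth_in_polys:
  fixes p :: "complex poly" and m :: "'n::finite"
  assumes "degree p \<le> d"
  shows "(\<lambda>z :: complex ^ 'n. poly p (z $ m)) \<in> polys d"
proof -
  let ?s = "\<lambda>k. (\<chi> i. if i = m then k else 0) :: nat ^ 'n"
  let ?S = "{\<beta> :: nat ^ 'n. mdeg \<beta> \<le> d}"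
  \<comment> \<open>The support consists of the multiples of the \<open>m\<close>-th unit vector,
    the exponents of the powers of \<open>z $ m\<close>.\<close>
  define c where "c \<beta> = (if \<beta> \<in> range ?s then coeff p (\<beta> $ m) else 0)" for \<beta>
  have inj: "inj_on ?s {..d}"
    by (rule inj_onI) (auto simp: Finite_Cartesian_Product.vec_eq_iff dest: spec[of _ m])
  have sub: "?s ` {..d} \<subseteq> ?S" by (auto simp: mdeg_def)
  have mem: "\<beta> \<in> ?s ` {..d}" if "\<beta> \<in> ?S" "\<beta> \<in> range ?s" for \<beta>
    using that by (auto simp: mdeg_def)
  have "poly p (z $ m) = (\<Sum>\<beta> | mdeg \<beta> \<le> d. c \<beta> * zpow z \<beta>)" for z :: "complex ^ 'n"
  proof -
    have "poly p (z $ m) = (\<Sum>k\<le>d. coeff p k * z $ m ^ k)"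
      unfolding poly_altdef using assms
      by (intro sum.mono_neutral_left) (auto simp: coeff_eq_0)
    also have "\<dots> = (\<Sum>k\<le>d. c (?s k) * zpow z (?s k))"
      by (simp add: c_def zpow_single)
    also have "\<dots> = (\<Sum>\<beta>\<in>?s ` {..d}. c \<beta> * zpow z \<beta>)"
      using sum.reindex[OF inj, of "\<lambda>\<beta>. c \<beta> * zpow z \<beta>"] by simp
    also have "\<dots> = (\<Sum>\<beta>\<in>?S. c \<beta> * zpow z \<beta>)"
      using sub finite_mdeg_le mem by (intro sum.mono_neutral_left) (auto simp: c_def)
    finally show ?thesis .
  qed
  then show ?thesis unfolding polys_def by blast
qed

text \<open>As no factor is empty, a point of \<open>Kc m\<close> extends to a point of the product,
  so the \<open>m\<close>-th projection is onto \<open>Kc m\<close>.\<close>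

lemma sup_norm_nth:
  fixes Kc :: "'n::finite \<Rightarrow> complex set"
  assumes "\<And>i. Kc i \<noteq> {}"
  shows "sup_norm {z :: complex ^ 'n. \<forall>i. z $ i \<in> Kc i} (\<lambda>z. f (z $ m)) = sup_norm (Kc m) f"
proof -
  have "\<forall>i. \<exists>w. w \<in> Kc i" using assms by auto
  then obtain a where a: "\<And>i. a i \<in> Kc i" by metis
  have "(\<lambda>z. z $ m) ` {z. \<forall>i. z $ i \<in> Kc i} = Kc m"
  proof (intro equalityI subsetI)
    fix w assume "w \<in> Kc m"
    then show "w \<in> (\<lambda>z. z $ m) ` {z. \<forall>i. z $ i \<in> Kc i}"
      using a by (intro image_eqI[of _ _ "\<chi> i. if i = m then w else a i"]) auto
  qed auto
  then have "(\<lambda>w. cmod (f w)) ` (\<lambda>z. z $ m) ` {z. \<forall>i. z $ i \<in> Kc i} = (\<lambda>w. cmod (f w)) ` Kc m"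
    by simp
  then show ?thesis unfolding sup_norm_def image_image by simp
qed

lemma sup_norm_pderiv_le:
  fixes Kc :: "'n::finite \<Rightarrow> complex set"
  assumes "bernstein_set M {z. \<forall>i. z $ i \<in> Kc i}" "\<And>i. Kc i \<noteq> {}" "degree p \<le> d"
  shows "sup_norm (Kc m) (poly (pderiv p)) \<le> M * real d * sup_norm (Kc m) (poly p)"
proof -
  have "partial_deriv m (\<lambda>z. poly p (z $ m)) = (\<lambda>z. poly (pderiv p) (z $ m))"
    unfolding partial_deriv_def by (auto intro!: DERIV_imp_deriv poly_DERIV)
  moreover have "sup_norm {z. \<forall>i. z $ i \<in> Kc i} (\<lambda>z. poly q (z $ m)) = sup_norm (Kc m) (poly q)" for q
    by (rule sup_norm_nth[OF assms(2)])
  ultimately show ?thesis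
    using assms(1)[unfolded bernstein_set_def, rule_format, OF poly_nth_in_polys[OF assms(3)], of m m]
    by simp
qed

text \<open>Each derivative multiplies the top coefficient by the current degree bound, and the
  Bernstein inequality loses the same factor, so only a power of \<open>M\<close> remains. For monic
  \<open>p\<close> this bounds the supremum norm from below.\<close>

lemma norm_coeff_le_sup_norm:
  fixes Kc :: "'n::finite \<Rightarrow> complex set"
  assumes "M > 0" "bernstein_set M {z. \<forall>i. z $ i \<in> Kc i}" "\<And>i. Kc i \<noteq> {}" "degree p \<le> d"
  shows "cmod (coeff p d) \<le> M ^ d * sup_norm (Kc m) (poly p)"
  using assms(4)
proof (induction d arbitrary: p)
  case 0
  then obtain a where "p = [:a:]" by (metis degree_eq_zeroE le_zero_eq)
  \<comment> \<open>Over the nonempty set \<open>Kc m\<close> the supremum of a constant is its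
    modulus.\<close>
  then show ?case using assms(3) by (simp add: sup_norm_def)
next
  case (Suc d)
  have "real (Suc d) * cmod (coeff p (Suc d)) = cmod (coeff (pderiv p) d)"
    by (simp add: coeff_pderiv norm_mult del: of_nat_Suc)
  also have "\<dots> \<le> M ^ d * sup_norm (Kc m) (poly (pderiv p))"
    using Suc.prems by (intro Suc.IH) (simp add: degree_pderiv)
  also have "\<dots> \<le> M ^ d * (M * real (Suc d) * sup_norm (Kc m) (poly p))"
    using assms(1) sup_norm_pderiv_le[OF assms(2,3) Suc.prems] by (intro mult_left_mono) auto
  also have "\<dots> = real (Suc d) * (M ^ Suc d * sup_norm (Kc m) (poly p))"
    by (simp add: algebra_simps)
  finally show ?case by (simp del: of_nat_Suc)
qed

section \<open>Vandermonde determinants\<close>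

text \<open>Distributing the product over the sums picks one exponent per coordinate, so only
  monomials dividing \<open>zpow z \<beta>\<close> appear.\<close>

lemma prod_poly_eq_sum_zpow:
  fixes p :: "'n::finite \<Rightarrow> complex poly" and \<beta> :: "nat ^ 'n"
  assumes "\<And>m. degree (p m) \<le> \<beta> $ m"
  shows "(\<Prod>m\<in>UNIV. poly (p m) (z $ m)) =
    (\<Sum>\<gamma> | \<forall>m. \<gamma> $ m \<le> \<beta> $ m. (\<Prod>m\<in>UNIV. coeff (p m) (\<gamma> $ m)) * zpow z \<gamma>)"
proof -
  have "poly (p m) (z $ m) = (\<Sum>k\<le>\<beta> $ m. coeff (p m) k * z $ m ^ k)" for m
    unfolding poly_altdef using assms
    by (intro sum.mono_neutral_left) (auto simp: coeff_eq_0)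
  then have "(\<Prod>m\<in>UNIV. poly (p m) (z $ m)) =
      (\<Sum>g\<in>(\<Pi>\<^sub>E m\<in>UNIV. {..\<beta> $ m}). \<Prod>m\<in>UNIV. coeff (p m) (g m) * z $ m ^ g m)"
    by (simp add: prod_sum_PiE)
  also have "\<dots> = (\<Sum>\<gamma> | \<forall>m. \<gamma> $ m \<le> \<beta> $ m. (\<Prod>m\<in>UNIV. coeff (p m) (\<gamma> $ m)) * zpow z \<gamma>)"
    by (rule sum.reindex_bij_witness[of _ vec_nth vec_lambda])
      (auto simp: zpow_def prod.distrib PiE_UNIV_domain)
  finally show ?thesis .
qed

text \<open>The matrix \<open>?L\<close> of the change from monomials to Newton products is lower
  triangular with unit diagonal, so it preserves the determinant. The Newton products evaluated at
  the grid points form an upper triangular matrix, whose diagonal gives the right-hand side.\<close>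

lemma VDM_newton_grid:
  fixes x :: "'n::{finite,linorder} \<Rightarrow> nat \<Rightarrow> complex"
  shows "VDM k (\<lambda>j. \<chi> m. x m (enum_idx j $ m)) =
    (\<Prod>j<k. \<Prod>m\<in>UNIV. poly (newton (x m) (enum_idx j $ m)) (x m (enum_idx j $ m)))"
proof -
  let ?\<alpha> = "enum_idx :: nat \<Rightarrow> nat ^ 'n::{finite,linorder}"
  define \<xi> :: "nat \<Rightarrow> complex ^ 'n::{finite,linorder}" where "\<xi> j = (\<chi> m. x m (?\<alpha> j $ m))" for j
  define l where "l i j = (\<Prod>m\<in>UNIV. coeff (newton (x m) (?\<alpha> i $ m)) (?\<alpha> j $ m))" for i j
  define N where "N i z = (\<Prod>m\<in>UNIV. poly (newton (x m) (?\<alpha> i $ m)) (z $ m))" for i z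
  let ?L = "Matrix.mat k k (\<lambda>(i, j). l i j)"
  let ?E = "Matrix.mat k k (\<lambda>(i, j). e_mon i (\<xi> j))"
  let ?N = "Matrix.mat k k (\<lambda>(i, j). N i (\<xi> j))"
  have inj: "inj ?\<alpha>" and surj: "surj ?\<alpha>" using enum_idx(1) by (auto simp: bij_def)
  have l0: "l i j = 0" if ij: "i < j" for i j
  proof -
    obtain m where "?\<alpha> i $ m < ?\<alpha> j $ m" using enum_idx_less_at[OF ij] .
    then have "coeff (newton (x m) (?\<alpha> i $ m)) (?\<alpha> j $ m) = 0" by (intro coeff_eq_0) simp
    then show ?thesis unfolding l_def by (intro prod_zero) auto
  qed
  \<comment> \<open>The diagonal entries are products of leading coefficients of monic
    polynomials.\<close>
  have detL: "Determinant.det ?L = 1"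
    by (subst det_lower_triangular[of k])
      (auto simp: l0 prod_list_diag_prod, simp add: l_def)
  have detN: "Determinant.det ?N = (\<Prod>j<k. N j (\<xi> j))"
  proof (subst det_upper_triangular[of _ k])
    have "N i (\<xi> j) = 0" if ij: "j < i" for i j
    proof -
      \<comment> \<open>In this coordinate the grid point is one of the nodes of the
        \<open>i\<close>-th Newton factor.\<close>
      obtain m where "?\<alpha> j $ m < ?\<alpha> i $ m" using enum_idx_less_at[OF ij] .
      then have "poly (newton (x m) (?\<alpha> i $ m)) (\<xi> j $ m) = 0"
        unfolding \<xi>_def by (simp add: poly_newton_eq_0)
      then show ?thesis unfolding N_def by (intro prod_zero) auto
    qed
    then show "upper_triangular ?N" by auto
  qed (auto simp: prod_list_diag_prod atLeast0LessThan)
  have expand: "N i z = (\<Sum>j<k. l i j * e_mon j z)" if "i < k" for i z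
  proof -
    \<comment> \<open>A multi-index below \<open>?\<alpha> i\<close> in every entry is not
      enumerated after it, so the first \<open>k\<close> monomials suffice for the
      expansion.\<close>
    have sub: "{\<gamma>. \<forall>m. \<gamma> $ m \<le> ?\<alpha> i $ m} \<subseteq> ?\<alpha> ` {..<k}"
    proof
      fix \<gamma> assume "\<gamma> \<in> {\<gamma>. \<forall>m. \<gamma> $ m \<le> ?\<alpha> i $ m}"
      moreover obtain j where j: "\<gamma> = ?\<alpha> j" using surj by blast
      ultimately have "\<not> i < j" by (metis enum_idx_less_at mem_Collect_eq not_le)
      then show "\<gamma> \<in> ?\<alpha> ` {..<k}" using that j by auto
    qed
    let ?t = "\<lambda>\<gamma>. (\<Prod>m\<in>UNIV. coeff (newton (x m) (?\<alpha> i $ m)) (\<gamma> $ m)) * zpow z \<gamma>"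
    have "N i z = (\<Sum>\<gamma> | \<forall>m. \<gamma> $ m \<le> ?\<alpha> i $ m. ?t \<gamma>)"
      unfolding N_def by (rule prod_poly_eq_sum_zpow) simp
    also have "\<dots> = (\<Sum>\<gamma>\<in>?\<alpha> ` {..<k}. ?t \<gamma>)"
    proof (rule sum.mono_neutral_left[OF _ sub], simp, rule ballI)
      fix \<gamma> assume "\<gamma> \<in> ?\<alpha> ` {..<k} - {\<gamma>. \<forall>m. \<gamma> $ m \<le> ?\<alpha> i $ m}"
      then obtain m where "?\<alpha> i $ m < \<gamma> $ m" by (auto simp: not_le)
      then have "coeff (newton (x m) (?\<alpha> i $ m)) (\<gamma> $ m) = 0" by (intro coeff_eq_0) simp
      then have "(\<Prod>m\<in>UNIV. coeff (newton (x m) (?\<alpha> i $ m)) (\<gamma> $ m)) = 0"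
        by (intro prod_zero) auto
      then show "?t \<gamma> = 0" by simp
    qed
    also have "\<dots> = (\<Sum>j<k. l i j * e_mon j z)"
      using sum.reindex[OF inj_on_subset[OF inj subset_UNIV], of ?t "{..<k}"]
      by (simp add: l_def e_mon_def)
    finally show ?thesis .
  qed
  have "?N = ?L * ?E"
    by (rule eq_matI) (auto simp: expand scalar_prod_def atLeast0LessThan)
  then have "Determinant.det ?N = Determinant.det ?L * Determinant.det ?E"
    by (simp add: det_mult[of _ k])
  then show ?thesis unfolding detL detN by (simp add: VDM_def \<xi>_def N_def)
qed

text \<open>\<open>V_max\<close> is a real supremum, so a single configuration bounds it from below
  only once the set of values is known to be bounded. The Leibniz formula gives a bound, each
  monomial being bounded on the product.\<close>

lemma bdd_above_VDM:
  fixes Kc :: "'n::{finite,linorder} \<Rightarrow> complex set"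
  assumes "\<And>i. compact (Kc i)"
  shows "bdd_above ((\<lambda>\<xi>. cmod (VDM k \<xi>)) ` ({..<k} \<rightarrow> {z. \<forall>i. z $ i \<in> Kc i}))"
proof -
  obtain B where B: "\<And>i w. w \<in> Kc i \<Longrightarrow> cmod w \<le> B i"
    using compact_imp_bounded[OF assms] unfolding bounded_iff by metis
  define b where "b j = (\<Prod>m\<in>UNIV. B m ^ (enum_idx j $ m :: nat))" for j
  have e: "cmod (e_mon j z) \<le> b j" if "\<forall>i. z $ i \<in> Kc i" for j z
    unfolding e_mon_def zpow_def b_def prod_norm[symmetric] norm_power
    using B that by (intro prod_mono conjI power_mono) auto
  show ?thesis
  proof (rule bdd_aboveI2)
    fix \<xi> assume \<xi>: "\<xi> \<in> {..<k} \<rightarrow> {z. \<forall>i. z $ i \<in> Kc i}"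
    have "VDM k \<xi> = (\<Sum>p | p permutes {0..<k}. signof p * (\<Prod>i = 0..<k. e_mon i (\<xi> (p i))))"
      unfolding VDM_def det_def'[OF mat_carrier]
    proof (intro sum.cong refl arg_cong[of _ _ "(*) _"] prod.cong)
      fix p i assume "p \<in> {p. p permutes {0..<k}}" "i \<in> {0..<k}"
      then show "Matrix.mat k k (\<lambda>(i, j). e_mon i (\<xi> j)) $$ (i, p i) = e_mon i (\<xi> (p i))"
        using permutes_in_image[of p "{0..<k}" i] by simp
    qed
    then have "cmod (VDM k \<xi>) \<le>
        (\<Sum>p | p permutes {0..<k}. cmod (signof p * (\<Prod>i = 0..<k. e_mon i (\<xi> (p i)))))"
      by (simp only: norm_sum)
    also have "\<dots> \<le> (\<Sum>p | p permutes {0..<k}. \<Prod>i = 0..<k. b i)"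
    proof (rule sum_mono)
      fix p assume "p \<in> {p. p permutes {0..<k}}"
      then have "p i < k" if "i < k" for i
        using that permutes_in_image[of p "{0..<k}" i] by simp
      then have "(\<Prod>i = 0..<k. cmod (e_mon i (\<xi> (p i)))) \<le> (\<Prod>i = 0..<k. b i)"
        using \<xi> by (intro prod_mono conjI e) (auto simp: Pi_def)
      then show "cmod (signof p * (\<Prod>i = 0..<k. e_mon i (\<xi> (p i)))) \<le> (\<Prod>i = 0..<k. b i)"
        by (simp add: norm_mult prod_norm sign_def)
    qed
    finally show "cmod (VDM k \<xi>) \<le> (\<Sum>p | p permutes {0..<k}. \<Prod>i = 0..<k. b i)" .
  qed
qed

lemma V_max_ge:
  fixes Kc :: "'n::{finite,linorder} \<Rightarrow> complex set"
  assumes "M > 0" "\<And>i. compact (Kc i)" "\<And>i. Kc i \<noteq> {}"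
    and "bernstein_set M {z. \<forall>i. z $ i \<in> Kc i}"
  shows "(1 / M) ^ (\<Sum>j<k. mdeg (enum_idx j :: nat ^ 'n::{finite,linorder})) \<le> V_max k {z. \<forall>i. z $ i \<in> Kc i}"
proof -
  obtain x where x: "\<And>m k. x m k \<in> Kc m"
    "\<And>m k. cmod (poly (newton (x m) k) (x m k)) = sup_norm (Kc m) (poly (newton (x m) k))"
    using exists_leja_sequence[OF assms(2,3)] by metis
  \<comment> \<open>The coefficient estimate is applied to a monic polynomial, whose norm the Leja
    point attains.\<close>
  have ge: "(1 / M) ^ k \<le> cmod (poly (newton (x m) k) (x m k))" for m k
    using norm_coeff_le_sup_norm[OF assms(1,4,3), of "newton (x m) k" k m] assms(1)
    by (simp add: x(2) field_simps)
  let ?\<xi> = "\<lambda>j. (\<chi> m. x m (enum_idx j $ m)) :: complex ^ 'n::{finite,linorder}"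
  have "(1 / M) ^ (\<Sum>j<k. mdeg (enum_idx j :: nat ^ 'n::{finite,linorder})) =
      (\<Prod>j<k. \<Prod>m\<in>UNIV. (1 / M) ^ ((enum_idx j :: nat ^ 'n::{finite,linorder}) $ m))"
    by (simp add: mdeg_def power_sum)
  also have "\<dots> \<le> cmod (VDM k ?\<xi>)"
    unfolding VDM_newton_grid prod_norm[symmetric]
    using assms(1) ge by (intro prod_mono conjI prod_nonneg) auto
  also have "\<dots> \<le> V_max k {z. \<forall>i. z $ i \<in> Kc i}"
    unfolding V_max_def by (intro cSUP_upper bdd_above_VDM assms(2)) (auto simp: x(1))
  finally show ?thesis .
qed

theorem theorem1p2:
  fixes M :: real
    and Kc :: "'n::{finite,linorder} \<Rightarrow> complex set"
    and K :: "(complex ^ 'n::{finite,linorder}) set"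
  assumes "M > 0"
    and "\<And>i. compact (Kc i)"
    and "\<And>i. Kc i \<noteq> {}"
    and "K = {z. \<forall>i. z $ i \<in> Kc i}"
    and "bernstein_set M K"
  shows "transfinite_diameter K \<ge> ereal (1 / M)"
proof -
  \<comment> \<open>At \<open>d = 0\<close> the exponent \<open>1 / real 0\<close> is 0 and the term
    equals 1, which may be smaller than \<open>1 / M\<close>; the limsup ignores this term.\<close>
  have "1 / M \<le> V_max (h_num CARD('n) d) K powr (1 / real (l_num CARD('n) d))" if "d \<ge> 1" for d
  proof -
    let ?l = "l_num CARD('n) d"
    have "?l > 0" using that by (simp add: l_num_eq zero_less_binomial_iff)
    then have "1 / M = ((1 / M) ^ ?l) powr (1 / real ?l)"
      using assms(1) by (simp add: powr_powr flip: powr_realpow)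
    also have "\<dots> \<le> V_max (h_num CARD('n) d) K powr (1 / real ?l)"
      using V_max_ge[OF assms(1,2,3) assms(5)[unfolded assms(4)], of "h_num CARD('n) d"] assms(1)
      by (intro powr_mono2) (auto simp: sum_mdeg_enum_idx assms(4))
    finally show ?thesis .
  qed
  then show ?thesis unfolding transfinite_diameter_def
    by (intro le_Limsup) (auto intro: eventually_sequentiallyI[of 1])
qed

end
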